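(* Let $d\ge 1$, $L\ge 0$ and $1\le l\le 2^{dL}$ be integers. Let $\phi_{d,L,l}$ denote the fraction of continuous segments among all segments of length $l$ of the level-$L$, $d$-dimensional cubical Morton curve. Then $$\phi_{d,L,l}\ \ge\ \frac{1}{2^d-1}.$$
   Context: Morton index: an integer $Q\in\{0,\dots,2^{dL}-1\}$ is written in binary with $dL$ bits as $Q=(q^1 q^2\ldots q^L)_2$, where each block is $q^\ell=(q^\ell_d\ldots q^\ell_1)_2$ with bits $q^\ell_i\in\{0,1\}$. For $1\le r\le d$ put $Q_r=(q^1_r q^2_r\ldots q^L_r)_2$. The quadrant with index $Q$ occupies $\Omega(Q)=\prod_{r=1}^d[2^{-L}Q_r,2^{-L}(Q_r+1)]\subset[0,1]^d$. A segment of length $l$ of the level-$L$ Morton curve is a set of $l$ consecutive indices $\{Q^{\text{start}},Q^{\text{start}}+1,\dots,Q^{\text{start}}+l-1\}\subset\{0,\dots,2^{dL}-1\}$; there are $2^{dL}-(l-1)$ of them. Two indices are face-adjacent if the cubes $\Omega(\cdot)$ share a common $(d-1)$-dimensional face. A segment is continuous if it consists of one face-connected piece, i.e. if the graph on its indices given by face-adjacency is connected. Thus $\phi_{d,L,l}$ is the number of continuous segments of length $l$ divided by $2^{dL}-(l-1)$. *)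

theory Defs
  imports Complex_Main "HOL-Library.FuncSet" "Graph_Theory.Digraph_Component"
begin

(* The bit q^b_i of Q (block 1 \<le> b \<le> L, direction 1 \<le> i \<le> d).  Block 1 is the most significant
   one and, inside a block, direction d is the most significant one; see morton_binary below. *)
definition morton_bit :: "nat \<Rightarrow> nat \<Rightarrow> nat \<Rightarrow> nat \<Rightarrow> nat \<Rightarrow> nat" where
  "morton_bit d L Q b i = of_bool (bit Q (d * (L - b) + (i - 1)))"

lemma morton_binary:
  assumes "Q < 2 ^ (d * L)"
  shows "Q = (\<Sum>b=1..L. \<Sum>i=1..d. morton_bit d L Q b i * 2 ^ (d * (L - b) + (i - 1)))"
proof -
  have "take_bit (d * L) Q
      = (\<Sum>b=1..L. \<Sum>i=1..d. morton_bit d L Q b i * 2 ^ (d * (L - b) + (i - 1)))"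
  proof (induction L)
    case 0
    then show ?case by simp
  next
    case (Suc L)
    let ?g = "\<lambda>k. push_bit k (of_bool (bit Q k) :: nat)"
    have "take_bit (d * Suc L) Q = (\<Sum>k=0..<d * L + d. ?g k)"
      by (simp add: take_bit_sum add.commute)
    also have "\<dots> = (\<Sum>k=0..<d * L. ?g k) + (\<Sum>k=d * L..<d * L + d. ?g k)"
      by (subst sum.atLeastLessThan_concat) auto
    also have "(\<Sum>k=d * L..<d * L + d. ?g k)
        = (\<Sum>i=1..d. morton_bit d (Suc L) Q 1 i * 2 ^ (d * (Suc L - 1) + (i - 1)))"
      by (rule sum.reindex_bij_witness[of _ "\<lambda>i. d * L + (i - 1)" "\<lambda>k. Suc (k - d * L)"])
         (auto simp: morton_bit_def push_bit_eq_mult)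
    also have "(\<Sum>k=0..<d * L. ?g k)
        = (\<Sum>b=1..L. \<Sum>i=1..d. morton_bit d L Q b i * 2 ^ (d * (L - b) + (i - 1)))"
      using Suc.IH by (simp only: take_bit_sum)
    also have "\<dots> = (\<Sum>b=Suc 1..Suc L. \<Sum>i=1..d.
        morton_bit d (Suc L) Q b i * 2 ^ (d * (Suc L - b) + (i - 1)))"
      by (subst sum.shift_bounds_cl_Suc_ivl) (simp add: morton_bit_def)
    finally show ?case
      by (subst sum.atLeast_Suc_atMost) simp_all
  qed
  moreover have "take_bit (d * L) Q = Q"
    using assms by (simp add: take_bit_nat_eq_self)
  ultimately show ?thesis by simp
qed

(* The integer Q_r = (q^1_r q^2_r ... q^L_r)_2. *)
definition morton_coord :: "nat \<Rightarrow> nat \<Rightarrow> nat \<Rightarrow> nat \<Rightarrow> nat" where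
  "morton_coord d L Q r = (\<Sum>b=1..L. morton_bit d L Q b r * 2 ^ (L - b))"

definition lower_end :: "nat \<Rightarrow> nat \<Rightarrow> nat \<Rightarrow> nat \<Rightarrow> real" where
  "lower_end d L Q r = real (morton_coord d L Q r) / 2 ^ L"

definition upper_end :: "nat \<Rightarrow> nat \<Rightarrow> nat \<Rightarrow> nat \<Rightarrow> real" where
  "upper_end d L Q r = (real (morton_coord d L Q r) + 1) / 2 ^ L"

(* Points of d-dimensional space are functions on {1..d} (undefined elsewhere). *)
definition Omega :: "nat \<Rightarrow> nat \<Rightarrow> nat \<Rightarrow> (nat \<Rightarrow> real) set" where
  "Omega d L Q = (\<Pi>\<^sub>E r\<in>{1..d}. {lower_end d L Q r..upper_end d L Q r})"

(* F is a k-dimensional face of the cube Omega d L Q: the coordinates in some k-element set J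
   range freely, each of the others is fixed at one of its two ends. *)
definition cube_face :: "nat \<Rightarrow> nat \<Rightarrow> nat \<Rightarrow> nat \<Rightarrow> (nat \<Rightarrow> real) set \<Rightarrow> bool" where
  "cube_face d L Q k F \<longleftrightarrow>
     (\<exists>J v. J \<subseteq> {1..d} \<and> card J = k \<and>
        (\<forall>r\<in>{1..d} - J. v r = lower_end d L Q r \<or> v r = upper_end d L Q r) \<and>
        F = {x \<in> Omega d L Q. \<forall>r\<in>{1..d} - J. x r = v r})"

definition face_adjacent :: "nat \<Rightarrow> nat \<Rightarrow> nat \<Rightarrow> nat \<Rightarrow> bool" where
  "face_adjacent d L Q Q' \<longleftrightarrow>
     Q \<noteq> Q' \<and> (\<exists>F. cube_face d L Q (d - 1) F \<and> cube_face d L Q' (d - 1) F)"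

definition segments :: "nat \<Rightarrow> nat \<Rightarrow> nat \<Rightarrow> nat set set" where
  "segments d L l = {{s..<s + l} | s. {s..<s + l} \<subseteq> {..<2 ^ (d * L)}}"

(* Undirected graph, represented by its symmetric arc relation. *)
definition adjacency_graph :: "nat \<Rightarrow> nat \<Rightarrow> nat set \<Rightarrow> nat pair_pre_digraph" where
  "adjacency_graph d L S =
     \<lparr>pverts = S, parcs = {(Q, Q'). Q \<in> S \<and> Q' \<in> S \<and> face_adjacent d L Q Q'}\<rparr>"

definition continuous_segment :: "nat \<Rightarrow> nat \<Rightarrow> nat set \<Rightarrow> bool" where
  "continuous_segment d L S \<longleftrightarrow> connected (with_proj (adjacency_graph d L S))"

definition phi :: "nat \<Rightarrow> nat \<Rightarrow> nat \<Rightarrow> real" where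
  "phi d L l =
     real (card {S \<in> segments d L l. continuous_segment d L S}) / real (card (segments d L l))"

lemma card_segments:
  assumes "1 \<le> l" "l \<le> 2 ^ (d * L)"
  shows "card (segments d L l) = 2 ^ (d * L) - (l - 1)"
proof -
  have *: "{s..<s + l} \<subseteq> {..<2 ^ (d * L)} \<longleftrightarrow> s < 2 ^ (d * L) - (l - 1)" for s
  proof
    assume "{s..<s + l} \<subseteq> {..<2 ^ (d * L)}"
    moreover have "s + (l - 1) \<in> {s..<s + l}" using assms by auto
    ultimately have "s + (l - 1) \<in> {..<2 ^ (d * L)}" by blast
    then show "s < 2 ^ (d * L) - (l - 1)" by auto
  qed auto
  have "segments d L l = (\<lambda>s. {s..<s + l}) ` {..<2 ^ (d * L) - (l - 1)}"
    unfolding segments_def * by auto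
  moreover have "inj (\<lambda>s. {s..<s + l})"
    using assms by (auto simp: inj_def atLeastLessThan_eq_iff)
  ultimately show ?thesis
    by (simp add: card_image inj_on_subset)
qed

end

(* Incrementing one coordinate turns a block 0 1 ... 1 of its bits into 1 0 ... 0.  In the Morton
   index these bits sit at positions k, k - d, k - 2d, ..., so with R = carry d k the increment is
   z + R -> z + 2^k for a z that vanishes at all of them.  Taking z to be as small or as large as
   possible below 2^k shows that heads and tails of aligned blocks of length 2^k are connected, and
   a segment made of a tail [u, 2^k) and a head [0, v) of two sibling blocks is connected once
   z < v and u <= z + R for some such z.

   Let 2^k be the least power of two with l <= 2^k and put f = 2^k - l.  A segment inside an aligned
   block of length M = 2^k is a tail plus a head with v > u, hence connected; these are the offsets
   0..f in each block.  As (R + 1) (2^d - 1) >= M, this suffices if f >= R.  Otherwise the segments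
   across two sibling blocks contribute, via the smallest and the largest z, further offsets so that
   0..R and M+f-R..M+f are good in each block of length 2M: again a proportion (R + 1) / M.  When
   d = 1 or M = 2^(dL), every segment is connected. *)

theory Submission
  imports Defs
begin

section \<open>Size and binary digits of the carry R\<close>

fun carry :: "nat \<Rightarrow> nat \<Rightarrow> nat" where
  "carry d k = (if k < d \<or> d = 0 then 0 else 2 ^ (k - d) + carry d (k - d))"

declare carry.simps [simp del]

lemma carry_less: "carry d k < 2 ^ k"
proof (induction d k rule: carry.induct)
  case (1 d k)
  show ?case
  proof (cases "k < d \<or> d = 0")
    case True
    then show ?thesis by (simp add: carry.simps)
  next
    case False
    then have "carry d k < 2 ^ (k - d) + 2 ^ (k - d)"
      using 1 by (simp add: carry.simps[of d k])
    also have "\<dots> = 2 ^ Suc (k - d)" by simp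
    also have "\<dots> \<le> 2 ^ k" using False by (intro power_increasing) auto
    finally show ?thesis .
  qed
qed

text \<open>If nonzero, R has top bit \<open>k - d\<close>, so R < 2^(k-d+1) \<le> 2^(k-1) when d
  \<ge> 2. This later keeps two ranges of good offsets disjoint.\<close>

lemma double_carry_less:
  assumes "2 \<le> d"
  shows "2 * carry d k < 2 ^ k"
proof (cases "k < d")
  case True
  then show ?thesis by (simp add: carry.simps)
next
  case False
  then have "2 * carry d k < 2 * (2 ^ (k - d) + 2 ^ (k - d))"
    using carry_less[of d "k - d"] assms by (simp add: carry.simps[of d k])
  also have "\<dots> = 2 ^ (k - d + 2)" by simp
  also have "\<dots> \<le> 2 ^ k" using False assms by (intro power_increasing) auto
  finally show ?thesis .
qed

text \<open>Source of the constant 2^d - 1: passing from k - d to k adds 2^(k-d) to R, and 2^(k-d) *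
  (2^d - 1) is exactly the growth from 2^(k-d) to 2^k.\<close>

lemma carry_ge:
  assumes "1 \<le> d"
  shows "2 ^ k \<le> (carry d k + 1) * (2 ^ d - 1)"
  using assms
proof (induction d k rule: carry.induct)
  case (1 d k)
  show ?case
  proof (cases "k < d")
    case True
    then have "(2::nat) ^ k \<le> 2 ^ d - 1"
      using power_strict_increasing[of k d "2::nat"] by linarith
    with True show ?thesis by (simp add: carry.simps)
  next
    case False
    then have "2 ^ (k - d) \<le> (carry d (k - d) + 1) * (2 ^ d - 1)"
      using 1 by simp
    moreover have "(2::nat) ^ k = 2 ^ (k - d) * (2 ^ d - 1) + 2 ^ (k - d)"
    proof -
      have "(2::nat) ^ k = 2 ^ (k - d) * 2 ^ d"
        using False by (simp flip: power_add)
      also have "\<dots> = 2 ^ (k - d) * ((2 ^ d - 1) + 1)" by simp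
      finally show ?thesis by (simp only: distrib_left mult_1_right)
    qed
    moreover have "carry d k = 2 ^ (k - d) + carry d (k - d)"
      using False 1(2) by (simp add: carry.simps[of d k])
    ultimately show ?thesis by (simp only: distrib_right add.assoc)
  qed
qed

lemma bit_less_exp: "bit (w::nat) i \<Longrightarrow> w < 2 ^ k \<Longrightarrow> i < k"
  by (metis bit_take_bit_iff take_bit_nat_eq_self)

text \<open>The ones of R fill the residue class of k modulo d below k, that is, the lower bits of
  the coordinate to which bit k belongs.\<close>

lemma bit_carry_iff: "bit (carry d k) i \<longleftrightarrow> i < k \<and> d dvd k - i"
proof (induction d k rule: carry.induct)
  case (1 d k)
  show ?case
  proof (cases "k < d \<or> d = 0")
    case True
    then show ?thesis by (auto simp: carry.simps dest: dvd_imp_le)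
  next
    case False
    then have IH: "bit (carry d (k - d)) i \<longleftrightarrow> i < k - d \<and> d dvd k - d - i"
      using 1 by simp
    \<comment> \<open>The remaining carry is below 2^(k-d), so the two summands share no
      bit.\<close>
    have "2 ^ (k - d) + carry d (k - d) = or (2 ^ (k - d)) (carry d (k - d))"
      using carry_less[of d "k - d"]
      by (intro disjunctive_add_eq_or bit_eqI) (auto simp: bit_simps dest: bit_less_exp)
    then have "bit (carry d k) i \<longleftrightarrow> i = k - d \<or> bit (carry d (k - d)) i"
      using False by (simp add: carry.simps[of d k] bit_simps)
    also have "\<dots> \<longleftrightarrow> i = k - d \<or> i < k - d \<and> d dvd k - d - i"
      by (simp add: IH)
    also have "\<dots> \<longleftrightarrow> i < k \<and> d dvd k - i"
    proof (cases "i \<le> k - d")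
      case True
      then have "k - i = (k - d - i) + d" using False by linarith
      then have "d dvd k - i \<longleftrightarrow> d dvd k - d - i" by (simp only: dvd_add_triv_right_iff)
      moreover have "i < k" "i < k - d \<or> i = k - d" using True False by linarith+
      ultimately show ?thesis by fastforce
    next
      case *: False
      then show ?thesis using False by (auto dest!: dvd_imp_le)
    qed
    finally show ?thesis .
  qed
qed

lemma carry_one: "carry 1 k = 2 ^ k - 1"
proof -
  have "carry 1 k = mask k" by (rule bit_eqI) (simp add: bit_carry_iff bit_simps)
  then show ?thesis by (simp add: mask_eq_exp_minus_1)
qed

section \<open>Offsets that vanish at the carry positions\<close>

definition clear :: "nat \<Rightarrow> nat \<Rightarrow> nat \<Rightarrow> bool" where
  "clear d k w \<longleftrightarrow> w < 2 ^ k \<and> and w (carry d k) = 0"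

lemma clear_zero: "clear d k 0"
  by (simp add: clear_def)

text \<open>Numbers with disjoint bits add like \<open>or\<close>, which cannot create a bit at or
  above k.\<close>

lemma clear_add_carry_less:
  assumes "clear d k w"
  shows "w + carry d k < 2 ^ k"
proof -
  have "w + carry d k = or w (carry d k)"
    using assms by (intro disjunctive_add_eq_or) (simp add: clear_def)
  also have "\<dots> = take_bit k \<dots>"
    using assms carry_less[of d k] by (simp add: clear_def take_bit_nat_eq_self)
  finally show ?thesis by (metis take_bit_nat_less_exp)
qed

text \<open>Erasing the carry positions from \<open>u\<close> gives \<open>w\<close>; the erased
  part is a submask of R and hence at most R.\<close>

lemma clear_exists:
  assumes "u < 2 ^ k"
  obtains w where "clear d k w" "w \<le> u" "u \<le> w + carry d k" "w + carry d k < 2 ^ k"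
proof -
  define c where "c = carry d k"
  define w where "w = xor u (and u c)"
  have "w + and u c = xor w (and u c)"
    by (intro disjunctive_add_eq_xor) (auto simp: w_def bit_eq_iff bit_simps)
  also have "\<dots> = u"
    by (auto simp: w_def bit_eq_iff bit_simps)
  finally have u: "w + and u c = u" .
  have z: "and w c = 0" by (auto simp: w_def bit_eq_iff bit_simps)
  have w: "w < 2 ^ k" using u assms by linarith
  have "and u c \<le> c" by (metis and.commute and_nat_def nat_le_iff AND_upper1 of_nat_0_le_iff)
  then have "u \<le> w + c" using u by linarith
  moreover have "clear d k w" using w z by (simp add: clear_def c_def)
  ultimately show thesis
    using that[of w] u clear_add_carry_less by (simp add: c_def)
qed

text \<open>For \<open>u\<close> consisting of k ones, the bounds squeeze
  \<open>w + carry d k\<close> to 2^k - 1. By \<open>clear_add_carry_less\<close> no clear number is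
  larger.\<close>

lemma clear_max: "clear d k (2 ^ k - 1 - carry d k)"
proof -
  obtain w where "clear d k w" "2 ^ k - 1 \<le> w + carry d k" "w + carry d k < 2 ^ k"
    by (rule clear_exists[of "2 ^ k - 1" k d]) auto
  then have "w = 2 ^ k - 1 - carry d k" by linarith
  with \<open>clear d k w\<close> show ?thesis by simp
qed

section \<open>Face adjacency from a binary increment\<close>

lemma morton_coord_eq:
  "morton_coord d L Q r = (\<Sum>j<L. of_bool (bit Q (d * j + (r - 1))) * 2 ^ j)"
  unfolding morton_coord_def morton_bit_def
  by (rule sum.reindex_bij_witness[of _ "\<lambda>j. L - j" "\<lambda>b. L - b"]) auto

text \<open>The common face lies in the hyperplane where coordinate \<open>r0\<close> equals the
  upper end of \<open>Q\<close>, which is the lower end of \<open>Q'\<close>; in every other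
  direction the two intervals coincide.\<close>

lemma face_adjacentI:
  assumes "1 \<le> r0" "r0 \<le> d"
    and same: "\<And>r. 1 \<le> r \<Longrightarrow> r \<le> d \<Longrightarrow> r \<noteq> r0 \<Longrightarrow> morton_coord d L Q r = morton_coord d L Q' r"
    and succ: "morton_coord d L Q' r0 = morton_coord d L Q r0 + 1"
  shows "face_adjacent d L Q Q'"
proof -
  let ?J = "{1..d} - {r0}"
  let ?v = "upper_end d L Q"
  let ?F = "\<lambda>Q. {x \<in> Omega d L Q. \<forall>r\<in>{1..d} - ?J. x r = ?v r}"
  have J: "{1..d} - ?J = {r0}" "?J \<subseteq> {1..d}" "card ?J = d - 1"
    using assms(1,2) by auto
  have v: "lower_end d L Q' r0 = ?v r0"
    using succ by (simp add: lower_end_def upper_end_def)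
  have ivl: "lower_end d L Q' r = lower_end d L Q r" "upper_end d L Q' r = upper_end d L Q r"
    if "r \<in> {1..d}" "r \<noteq> r0" for r
    using same[of r] that by (auto simp: lower_end_def upper_end_def)
  have le: "lower_end d L P r \<le> upper_end d L P r" for P r
    by (simp add: lower_end_def upper_end_def divide_right_mono)
  have "x \<in> Omega d L Q \<longleftrightarrow> x \<in> Omega d L Q'" if "x r0 = ?v r0" for x
  proof -
    have "x r \<in> {lower_end d L Q r..upper_end d L Q r} \<longleftrightarrow>
          x r \<in> {lower_end d L Q' r..upper_end d L Q' r}" if "r \<in> {1..d}" for r
    proof (cases "r = r0")
      case True
      then show ?thesis using \<open>x r0 = ?v r0\<close> v le[of Q r0] le[of Q' r0] by simp
    next
      case False
      then show ?thesis using ivl that by simp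
    qed
    then show ?thesis unfolding Omega_def PiE_iff by blast
  qed
  then have F: "?F Q = ?F Q'" unfolding J(1) by blast
  have "cube_face d L Q (d - 1) (?F Q)"
    unfolding cube_face_def using J by blast
  moreover have "cube_face d L Q' (d - 1) (?F Q')"
    unfolding cube_face_def using J v by (intro exI[of _ ?J] exI[of _ ?v]) auto
  moreover have "Q \<noteq> Q'" using succ by auto
  ultimately show ?thesis unfolding face_adjacent_def F by blast
qed

lemma face_adjacent_sym: "face_adjacent d L Q Q' \<Longrightarrow> face_adjacent d L Q' Q"
  unfolding face_adjacent_def by blast

lemma face_adjacent_carry:
  assumes k: "k < d * L" and z: "and z (or (2 ^ k) (carry d k)) = 0"
  shows "face_adjacent d L (z + carry d k) (z + 2 ^ k)"
proof -
  \<comment> \<open>Position k holds bit \<open>q\<close> of coordinate \<open>r0\<close>, counting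
    from 0 at the least significant bit.\<close>
  define r0 q where "r0 = k mod d + 1" and "q = k div d"
  have d: "0 < d" using k by (cases d) auto
  have q: "q < L" using k d by (simp add: q_def div_less_iff_less_mult mult.commute)
  have zb: "\<not> bit z i" if "i = k \<or> i < k \<and> d dvd k - i" for i
  proof -
    have "\<not> bit (and z (or (2 ^ k) (carry d k))) i" by (simp add: z)
    then show ?thesis using that by (auto simp: bit_simps bit_carry_iff)
  qed
  have "z + carry d k = or z (carry d k)"
    using zb by (intro disjunctive_add_eq_or) (auto simp: bit_eq_iff bit_simps bit_carry_iff)
  then have bx: "bit (z + carry d k) i \<longleftrightarrow> bit z i \<or> i < k \<and> d dvd k - i" for i
    by (simp add: bit_simps bit_carry_iff)
  have "z + 2 ^ k = or z (2 ^ k)"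
    using zb by (intro disjunctive_add_eq_or) (auto simp: bit_eq_iff bit_simps)
  then have b_y: "bit (z + 2 ^ k) i \<longleftrightarrow> bit z i \<or> i = k" for i
    by (auto simp: bit_simps)
  have decomp: "k = d * q + k mod d" by (simp add: q_def)
  show ?thesis
  proof (rule face_adjacentI[of r0])
    show "1 \<le> r0" "r0 \<le> d" using d by (auto simp: r0_def Suc_le_eq)
  next
    fix r assume r: "1 \<le> r" "r \<le> d" "r \<noteq> r0"
    \<comment> \<open>Bits of coordinate \<open>r\<close> sit at positions congruent to
      \<open>r - 1\<close> modulo d, whereas all altered positions are congruent to k.\<close>
    have "d * j + (r - 1) \<noteq> k" for j
    proof
      assume "d * j + (r - 1) = k"
      moreover have "(d * j + (r - 1)) mod d = r - 1"
        using r d by (simp only: mod_mult_self4) simp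
      ultimately show False using r by (simp add: r0_def)
    qed
    moreover have "\<not> (d * j + (r - 1) < k \<and> d dvd k - (d * j + (r - 1)))" for j
    proof
      assume *: "d * j + (r - 1) < k \<and> d dvd k - (d * j + (r - 1))"
      then obtain c where "k - (d * j + (r - 1)) = d * c" by blast
      then have "k = d * (j + c) + (r - 1)" using * by (simp add: distrib_left)
      then have "k mod d = (r - 1) mod d" by (simp only: mod_mult_self4)
      then have "k mod d = r - 1" using r d by simp
      then show False using r by (simp add: r0_def)
    qed
    ultimately show "morton_coord d L (z + carry d k) r = morton_coord d L (z + 2 ^ k) r"
      by (simp only: morton_coord_eq bx b_y simp_thms)
  next
    have pos: "d * j + (r0 - 1) < k \<longleftrightarrow> j < q" "d * j + (r0 - 1) = k \<longleftrightarrow> j = q" for j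
    proof -
      have "d * j + m < d * q + m \<longleftrightarrow> j < q" "d * j + m = d * q + m \<longleftrightarrow> j = q" for m
        using d by simp_all
      from this[of "k mod d"] show "d * j + (r0 - 1) < k \<longleftrightarrow> j < q" "d * j + (r0 - 1) = k \<longleftrightarrow> j = q"
        unfolding decomp[symmetric] by (simp_all add: r0_def)
    qed
    have dvd: "d dvd k - (d * j + (r0 - 1))" for j
    proof -
      have "d dvd d * q + m - (d * j + m)" for m by (simp flip: diff_mult_distrib2)
      from this[of "k mod d"] show ?thesis unfolding decomp[symmetric] by (simp add: r0_def)
    qed
    have zq: "\<not> bit z (d * j + (r0 - 1))" if "j \<le> q" for j
      using zb[of "d * j + (r0 - 1)"] pos[of j] dvd[of j] that by auto
    let ?z = "\<lambda>j. of_bool (bit z (d * j + (r0 - 1))) * 2 ^ j :: nat"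
    \<comment> \<open>In coordinate \<open>r0\<close> the carry contributes the bits 0 to
      \<open>q - 1\<close>, in total 2^q - 1, against the single bit 2^q on the other side.\<close>
    have "morton_coord d L (z + carry d k) r0 = (\<Sum>j<L. ?z j + (if j < q then 2 ^ j else 0))"
      unfolding morton_coord_eq bx pos using zq dvd by (intro sum.cong) auto
    also have "\<dots> = (\<Sum>j<L. ?z j) + (\<Sum>j<L. if j < q then 2 ^ j else 0)"
      by (rule sum.distrib)
    also have "(\<Sum>j<L. if j < q then 2 ^ j else 0) = (\<Sum>j<q. (2::nat) ^ j)"
      using q by (intro sum.mono_neutral_cong_right) auto
    also have "\<dots> = 2 ^ q - 1"
      by (simp add: lessThan_atLeast0 sum_power2)
    finally have x: "morton_coord d L (z + carry d k) r0 = (\<Sum>j<L. ?z j) + (2 ^ q - 1)" .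
    have "morton_coord d L (z + 2 ^ k) r0 = (\<Sum>j<L. ?z j + (if j = q then 2 ^ j else 0))"
      unfolding morton_coord_eq b_y pos using zq by (intro sum.cong) auto
    also have "\<dots> = (\<Sum>j<L. ?z j) + 2 ^ q"
      using q by (simp add: sum.distrib)
    finally show "morton_coord d L (z + 2 ^ k) r0 = morton_coord d L (z + carry d k) r0 + 1"
      using x by simp
  qed
qed

text \<open>A multiple of 2^(k+1) has no bits at or below k, so adding it to \<open>w\<close>
  preserves the vanishing condition: the same edge occurs in every aligned block of length
  2^(k+1).\<close>

lemma face_adjacent_clear:
  assumes "k < d * L" "clear d k w"
  shows "face_adjacent d L (q * 2 ^ Suc k + (w + carry d k)) (q * 2 ^ Suc k + (2 ^ k + w))"
proof -
  have w: "w < 2 ^ k" "and w (carry d k) = 0" using assms(2) by (auto simp: clear_def)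
  have low: "\<not> bit w i" if "i = k \<or> i < k \<and> d dvd k - i" for i
  proof
    assume "bit w i"
    then have "bit w i" "i < k" using w(1) bit_less_exp by auto
    then have "bit (and w (carry d k)) i" using that by (auto simp: bit_simps bit_carry_iff)
    then show False using w(2) by simp
  qed
  have "q * 2 ^ Suc k + w = or (push_bit (Suc k) q) w"
    unfolding push_bit_eq_mult[symmetric]
    using w(1) by (intro disjunctive_add_eq_or) (auto simp: bit_eq_iff bit_simps dest: bit_less_exp)
  then have "bit (q * 2 ^ Suc k + w) i \<longleftrightarrow> Suc k \<le> i \<and> bit q (i - Suc k) \<or> bit w i" for i
    by (auto simp only: bit_or_iff bit_push_bit_iff_nat)
  then have "and (q * 2 ^ Suc k + w) (or (2 ^ k) (carry d k)) = 0"
    using low by (intro bit_eqI) (auto simp: bit_simps bit_carry_iff)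
  from face_adjacent_carry[OF assms(1) this] show ?thesis
    by (simp only: ac_simps)
qed

section \<open>Connectivity through paths of adjacent indices\<close>

abbreviation adj :: "nat \<Rightarrow> nat \<Rightarrow> nat set \<Rightarrow> (nat \<times> nat) set" where
  "adj d L S \<equiv> {(Q, Q'). Q \<in> S \<and> Q' \<in> S \<and> face_adjacent d L Q Q'}"

lemma sym_rtrancl_adj: "sym ((adj d L S)\<^sup>*)"
  by (intro sym_rtrancl) (auto simp: sym_def intro: face_adjacent_sym)

text \<open>Adjacency is symmetric, so paths from all indices to one centre \<open>c\<close> can be
  reversed and joined.\<close>

lemma continuous_segmentI:
  assumes "c \<in> S" and reach: "\<And>x. x \<in> S \<Longrightarrow> (x, c) \<in> (adj d L S)\<^sup>*"
  shows "continuous_segment d L S"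
proof -
  let ?G = "with_proj (adjacency_graph d L S)"
  have parcs: "parcs (mk_symmetric ?G) = adj d L S"
    by (auto simp: parcs_mk_symmetric adjacency_graph_def intro: face_adjacent_sym)
  \<comment> \<open>Arcs of \<open>adj d L S\<close> have both ends in \<open>S\<close>, so a path
    starting in \<open>S\<close> never leaves it.\<close>
  have rt: "(x, y) \<in> rtrancl_on S (adj d L S)" if "(x, y) \<in> (adj d L S)\<^sup>*" "x \<in> S" for x y
    using that by (induction) (auto intro: rtrancl_on_into_rtrancl_on)
  have "(x, y) \<in> (adj d L S)\<^sup>*" if "x \<in> S" "y \<in> S" for x y
    using reach[OF that(1)] symD[OF sym_rtrancl_adj reach[OF that(2)]] by (rule rtrancl_trans)
  then have "\<forall>x\<in>S. \<forall>y\<in>S. (x, y) \<in> rtrancl_on S (adj d L S)"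
    using rt by blast
  moreover have "verts ?G = S" by (simp add: adjacency_graph_def)
  ultimately show ?thesis
    unfolding continuous_segment_def connected_def strongly_connected_def reachable_def
    using assms(1) by (auto simp: parcs)
qed

section \<open>Heads and tails of aligned blocks\<close>

lemma odd_part_exists:
  assumes "0 < (n::nat)"
  obtains q j where "n = q * 2 ^ Suc j + 2 ^ j"
  using assms
proof (induction n arbitrary: thesis rule: less_induct)
  case (less n)
  show ?case
  proof (cases "even n")
    case True
    then obtain m where m: "n = 2 * m" by blast
    moreover have "m < n" "0 < m" using m less.prems(2) by auto
    ultimately obtain q j where "m = q * 2 ^ Suc j + 2 ^ j" using less.IH by blast
    then show ?thesis using m by (intro less.prems(1)[of q "Suc j"]) simp
  next
    case False
    then obtain q where "n = 2 * q + 1" by (rule oddE)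
    then show ?thesis by (intro less.prems(1)[of q 0]) simp
  qed
qed

text \<open>With 2^j the lowest set bit of \<open>v\<close>, replacing it by
  \<open>carry d j\<close> gives an adjacent smaller offset (the edge for w = 0). Iterating descends
  to the block start inside the head.\<close>

lemma head_connected:
  assumes "k \<le> d * L" "v < 2 ^ k" "{p * 2 ^ k..p * 2 ^ k + v} \<subseteq> S"
  shows "(p * 2 ^ k + v, p * 2 ^ k) \<in> (adj d L S)\<^sup>*"
  using assms(2,3)
proof (induction v rule: less_induct)
  case (less v)
  show ?case
  proof (cases "v = 0")
    case False
    then have "0 < v" by simp
    then obtain q j where v: "v = q * 2 ^ Suc j + 2 ^ j" by (rule odd_part_exists)
    then have "(2::nat) ^ j < 2 ^ k" using less.prems(1) by linarith
    then have j: "j < k" by simp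
    define v' where "v' = q * 2 ^ Suc j + carry d j"
    have v': "v' < v" using carry_less[of d j] by (simp add: v v'_def)
    \<comment> \<open>As j < k, the block start is itself a multiple of 2^(j+1) and merges with the
      high part of \<open>v\<close>.\<close>
    have "(2::nat) ^ k = 2 ^ (k - Suc j) * 2 ^ Suc j"
      using j by (simp flip: power_add del: power_Suc)
    then have P: "p * 2 ^ k + q * 2 ^ Suc j = (p * 2 ^ (k - Suc j) + q) * 2 ^ Suc j"
      by (simp only: distrib_right mult.assoc)
    have "face_adjacent d L (p * 2 ^ k + v') (p * 2 ^ k + v)"
      using face_adjacent_clear[OF _ clear_zero, of j d L "p * 2 ^ (k - Suc j) + q"] j assms(1)
      unfolding P[symmetric] by (simp only: v v'_def add.assoc) simp
    then have "(p * 2 ^ k + v, p * 2 ^ k + v') \<in> adj d L S"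
      using less.prems v' by (auto intro: face_adjacent_sym)
    moreover have "(p * 2 ^ k + v', p * 2 ^ k) \<in> (adj d L S)\<^sup>*"
      using less.prems v' by (intro less.IH) auto
    ultimately show ?thesis by (rule converse_rtrancl_into_rtrancl)
  qed simp
qed

text \<open>Mirror image of the descent in a head: j is the lowest zero bit of \<open>u\<close>, all
  bits below it are ones, and the edge for the maximal clear \<open>w\<close> leads upwards because
  \<open>carry d j\<close> < 2^j.\<close>

lemma tail_step:
  assumes "k \<le> d * L" "u + 1 < 2 ^ k"
  obtains j where "face_adjacent d L (p * 2 ^ k + u) (p * 2 ^ k + (u + 2 ^ j - carry d j))"
    "u + 2 ^ j - carry d j < 2 ^ k"
proof -
  have "0 < u + 1" by simp
  then obtain q j where u: "u + 1 = q * 2 ^ Suc j + 2 ^ j" by (rule odd_part_exists)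
  then have "(2::nat) ^ j < 2 ^ k" using assms(2) by linarith
  then have j: "j < k" by simp
  define w where "w = 2 ^ j - 1 - carry d j"
  have c: "w + carry d j + 1 = 2 ^ j" using carry_less[of d j] by (simp add: w_def)
  have pow: "(2::nat) ^ k = 2 ^ (k - Suc j) * 2 ^ Suc j"
    using j by (simp flip: power_add del: power_Suc)
  then have P: "p * 2 ^ k + q * 2 ^ Suc j = (p * 2 ^ (k - Suc j) + q) * 2 ^ Suc j"
    by (simp only: distrib_right mult.assoc)
  have 1: "q * 2 ^ Suc j + (w + carry d j) = u"
    using u c by linarith
  have 2: "q * 2 ^ Suc j + (2 ^ j + w) = u + 2 ^ j - carry d j"
    using u c by linarith
  \<comment> \<open>Both ends lie in one aligned subblock of length 2^(j+1), which fits into the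
    block of length 2^k.\<close>
  have "q * 2 ^ Suc j < 2 ^ (k - Suc j) * 2 ^ Suc j"
    using u assms(2) pow by linarith
  then have "q + 1 \<le> 2 ^ (k - Suc j)" by simp
  then have "(q + 1) * 2 ^ Suc j \<le> 2 ^ k" unfolding pow by (rule mult_right_mono) simp
  then have "u + 2 ^ j - carry d j < 2 ^ k" using 2 c by simp
  moreover have "face_adjacent d L (p * 2 ^ k + u) (p * 2 ^ k + (u + 2 ^ j - carry d j))"
    using face_adjacent_clear[OF _ clear_max, of j d L "p * 2 ^ (k - Suc j) + q"] j assms(1)
    unfolding P[symmetric] w_def[symmetric] add.assoc 1 2 by simp
  ultimately show thesis by (intro that)
qed

lemma tail_connected:
  assumes "k \<le> d * L" "u < 2 ^ k" "{p * 2 ^ k + u..<p * 2 ^ k + 2 ^ k} \<subseteq> S"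
  shows "(p * 2 ^ k + u, p * 2 ^ k + (2 ^ k - 1)) \<in> (adj d L S)\<^sup>*"
  using assms(2,3)
proof (induction "2 ^ k - u" arbitrary: u rule: less_induct)
  case less
  show ?case
  proof (cases "u + 1 < 2 ^ k")
    case True
    then obtain j where j: "face_adjacent d L (p * 2 ^ k + u) (p * 2 ^ k + (u + 2 ^ j - carry d j))"
      "u + 2 ^ j - carry d j < 2 ^ k"
      using tail_step[OF assms(1)] by metis
    define u' where "u' = u + 2 ^ j - carry d j"
    have u': "u < u'" "u' < 2 ^ k" using carry_less[of d j] j(2) by (auto simp: u'_def)
    have "(p * 2 ^ k + u, p * 2 ^ k + u') \<in> adj d L S"
      using j(1) u' less.prems by (auto simp: u'_def[symmetric])
    moreover have "(p * 2 ^ k + u', p * 2 ^ k + (2 ^ k - 1)) \<in> (adj d L S)\<^sup>*"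
      using u' less.prems by (intro less.hyps) auto
    ultimately show ?thesis by (rule converse_rtrancl_into_rtrancl)
  next
    case False
    then have "u = 2 ^ k - 1" using less.prems(1) by linarith
    then show ?thesis by simp
  qed
qed

section \<open>Segments across a block boundary and within a block\<close>

lemma continuous_crossing:
  assumes k: "k < d * L" and w: "clear d k w" "w < v" "u \<le> w + carry d k"
    and u: "u < 2 ^ k" and v: "v \<le> 2 ^ k"
  shows "continuous_segment d L {q * 2 ^ Suc k + u..<q * 2 ^ Suc k + 2 ^ k + v}"
proof -
  define p where "p = q * 2 ^ Suc k"
  define S where "S = {p + u..<p + 2 ^ k + v}"
  have p: "p = (2 * q) * 2 ^ k" "p + 2 ^ k = (2 * q + 1) * 2 ^ k"
    by (simp_all add: p_def)
  have wc: "w + carry d k < 2 ^ k" using w(1) by (rule clear_add_carry_less)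
  have tail: "(p + x, p + (2 ^ k - 1)) \<in> (adj d L S)\<^sup>*" if "u \<le> x" "x < 2 ^ k" for x
    unfolding p(1) using that k
    by (intro tail_connected) (auto simp: S_def p(1)[symmetric])
  have head: "(p + 2 ^ k + y, p + 2 ^ k) \<in> (adj d L S)\<^sup>*" if "y < v" for y
  proof -
    have "{p + 2 ^ k..p + 2 ^ k + y} \<subseteq> S" using that u by (auto simp: S_def)
    then show ?thesis
      using head_connected[of k d L y "2 * q + 1" S] that k v unfolding p(2)[symmetric] by simp
  qed
  have "face_adjacent d L (p + (w + carry d k)) (p + 2 ^ k + w)"
    using face_adjacent_clear[OF k w(1), of q] by (simp add: p_def add.assoc)
  \<comment> \<open>The bound on \<open>u\<close> puts the left end of this edge into the tail, and
    w < v puts its right end into the head.\<close>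
  then have link: "(p + (w + carry d k), p + 2 ^ k + w) \<in> adj d L S"
    using w u wc by (auto simp: S_def)
  \<comment> \<open>Tail and head are joined by going back from the last tail index to the edge,
    across it, and down to the first head index.\<close>
  have "(p + (2 ^ k - 1), p + (w + carry d k)) \<in> (adj d L S)\<^sup>*"
    by (rule symD[OF sym_rtrancl_adj]) (use tail w wc in auto)
  also note link
  also have "(p + 2 ^ k + w, p + 2 ^ k) \<in> (adj d L S)\<^sup>*"
    using head w by blast
  finally have mid: "(p + (2 ^ k - 1), p + 2 ^ k) \<in> (adj d L S)\<^sup>*" .
  have "continuous_segment d L S"
  proof (rule continuous_segmentI)
    show "p + 2 ^ k \<in> S" using u w by (auto simp: S_def)
  next
    fix x assume x: "x \<in> S"
    show "(x, p + 2 ^ k) \<in> (adj d L S)\<^sup>*"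
    proof (cases "x < p + 2 ^ k")
      case True
      then have "(x, p + (2 ^ k - 1)) \<in> (adj d L S)\<^sup>*"
        using tail[of "x - p"] x by (auto simp: S_def)
      then show ?thesis using mid by (rule rtrancl_trans)
    next
      case False
      then show ?thesis using head[of "x - (p + 2 ^ k)"] x by (auto simp: S_def)
    qed
  qed
  then show ?thesis by (simp add: S_def p_def)
qed

text \<open>Being longer than half the box, the segment straddles the midpoint 2^m, and its head has
  length \<open>t + l - 2 ^ m\<close> > \<open>t\<close>. Thus \<open>t\<close> with its carry
  positions erased is a suitable \<open>w\<close>.\<close>

lemma continuous_within_box:
  assumes "k \<le> d * L" "2 ^ k < 2 * l" "t + l \<le> 2 ^ k"
  shows "continuous_segment d L {a * 2 ^ k + t..<a * 2 ^ k + t + l}"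
proof (cases k)
  case 0
  then have "{a * 2 ^ k + t..<a * 2 ^ k + t + l} = {a}" using assms(2,3) by auto
  moreover have "continuous_segment d L {a}" by (rule continuous_segmentI) auto
  ultimately show ?thesis by simp
next
  case (Suc m)
  have tl: "t < 2 ^ m" "2 ^ m < l" "t + l \<le> 2 ^ Suc m" using assms(2,3) by (auto simp: Suc)
  obtain w where w: "clear d m w" "w \<le> t" "t \<le> w + carry d m"
    using clear_exists[OF tl(1)] by metis
  have "a * 2 ^ Suc m + 2 ^ m + (t + l - 2 ^ m) = a * 2 ^ Suc m + t + l"
    using tl by linarith
  moreover have "continuous_segment d L
      {a * 2 ^ Suc m + t..<a * 2 ^ Suc m + 2 ^ m + (t + l - 2 ^ m)}"
    using assms(1) tl w by (intro continuous_crossing[where w = w]) (auto simp: Suc)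
  ultimately show ?thesis by (simp only: Suc)
qed

lemma continuous_across_boxes:
  assumes k: "k < d * L" and l: "l + f = 2 ^ k" and f: "f < carry d k" "2 * f < 2 ^ k"
    and t: "t \<in> {..carry d k} \<union> {2 ^ k + f - carry d k..2 ^ k + f}"
  shows "continuous_segment d L {a * 2 ^ Suc k + t..<a * 2 ^ Suc k + t + l}"
proof -
  note c = carry_less[of d k]
  \<comment> \<open>The four ranges are: inside the left block, crossing with w = 0, crossing with
    maximal w, inside the right block. A crossing segment has a head of length \<open>t - f\<close>,
    since t + l = 2^k + (t - f).\<close>
  consider "t \<le> f" | "f < t" "t \<le> carry d k" | "2 ^ k + f - carry d k \<le> t" "t < 2 ^ k"
    | "2 ^ k \<le> t" "t \<le> 2 ^ k + f"
    using t by fastforce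
  then show ?thesis
  proof cases
    case 1
    then have "continuous_segment d L {2 * a * 2 ^ k + t..<2 * a * 2 ^ k + t + l}"
      using k l f by (intro continuous_within_box) auto
    moreover have "2 * a * 2 ^ k = a * 2 ^ Suc k" by simp
    ultimately show ?thesis by (simp only:)
  next
    case 2
    then have "continuous_segment d L {a * 2 ^ Suc k + t..<a * 2 ^ Suc k + 2 ^ k + (t - f)}"
      using c by (intro continuous_crossing[OF k clear_zero]) auto
    moreover have "a * 2 ^ Suc k + 2 ^ k + (t - f) = a * 2 ^ Suc k + t + l"
      using 2 l by linarith
    ultimately show ?thesis by (simp only:)
  next
    case 3
    then have "continuous_segment d L {a * 2 ^ Suc k + t..<a * 2 ^ Suc k + 2 ^ k + (t - f)}"
      using c f by (intro continuous_crossing[OF k clear_max]) auto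
    moreover have "a * 2 ^ Suc k + 2 ^ k + (t - f) = a * 2 ^ Suc k + t + l"
      using 3 l f c by linarith
    ultimately show ?thesis by (simp only:)
  next
    case 4
    have "(2 * a + 1) * 2 ^ k + (t - 2 ^ k) = a * 2 ^ Suc k + t" using 4 by simp
    moreover have "continuous_segment d L
        {(2 * a + 1) * 2 ^ k + (t - 2 ^ k)..<(2 * a + 1) * 2 ^ k + (t - 2 ^ k) + l}"
      using 4 k l f by (intro continuous_within_box) auto
    ultimately show ?thesis by (simp only:)
  qed
qed

text \<open>For d = 1 the carry is 2^j - 1, so the edge of \<open>tail_step\<close> leads to the
  immediate successor.\<close>

lemma continuous_one_dim:
  assumes "s < e" "e \<le> 2 ^ L"
  shows "continuous_segment 1 L {s..<e}"
proof (rule continuous_segmentI)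
  show "e - 1 \<in> {s..<e}" using assms by auto
next
  have succ_adjacent: "face_adjacent 1 L x (x + 1)" if x: "x + 1 < 2 ^ L" for x
  proof -
    obtain j where "face_adjacent 1 L (0 * 2 ^ L + x) (0 * 2 ^ L + (x + 2 ^ j - carry 1 j))"
      using tail_step[of L 1 L x 0] x by auto
    then show ?thesis by (simp add: carry_one[simplified])
  qed
  fix x assume "x \<in> {s..<e}"
  then have "s \<le> x" "x \<le> e - 1" using assms by auto
  from this(2,1) show "(x, e - 1) \<in> (adj 1 L {s..<e})\<^sup>*"
  proof (induction rule: inc_induct)
    case (step n)
    have "(n, Suc n) \<in> adj 1 L {s..<e}"
      using step succ_adjacent[of n] assms by auto
    then show ?case using step by (meson converse_rtrancl_into_rtrancl le_SucI)
  qed simp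
qed

section \<open>Counting segments and the final estimate\<close>

lemma phi_eq_1:
  assumes "1 \<le> l" "l \<le> 2 ^ (d * L)"
    and "\<And>s. s + l \<le> 2 ^ (d * L) \<Longrightarrow> continuous_segment d L {s..<s + l}"
  shows "phi d L l = 1"
proof -
  have "continuous_segment d L S" if S: "S \<in> segments d L l" for S
  proof -
    obtain s where s: "S = {s..<s + l}" "S \<subseteq> {..<2 ^ (d * L)}"
      using S by (auto simp: segments_def)
    moreover have "s + l - 1 \<in> S" using s(1) assms(1) by auto
    ultimately show ?thesis using assms(3)[of s] by fastforce
  qed
  then have "{S \<in> segments d L l. continuous_segment d L S} = segments d L l" by blast
  moreover have "card (segments d L l) \<noteq> 0" using card_segments[OF assms(1,2)] assms(1,2) by simp
  ultimately show ?thesis by (simp add: phi_def)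
qed

text \<open>Each of the N aligned blocks of length 2^j contributes one continuous segment per offset
  in \<open>T\<close>, while at most N * 2^j segments exist in total.\<close>

lemma phi_ge:
  assumes d: "1 \<le> d" and l: "1 \<le> l" "l \<le> 2 ^ (d * L)" and j: "j \<le> d * L"
    and T: "\<And>t. t \<in> T \<Longrightarrow> t + l \<le> 2 ^ j"
    and cont: "\<And>a t. t \<in> T \<Longrightarrow> continuous_segment d L {a * 2 ^ j + t..<a * 2 ^ j + t + l}"
    and card_T: "2 ^ j \<le> card T * (2 ^ d - 1)"
  shows "1 / (2 ^ d - 1) \<le> phi d L l"
proof -
  define N :: nat where "N = 2 ^ (d * L - j)"
  define h where "h = (\<lambda>(a, t). {a * 2 ^ j + t..<a * 2 ^ j + t + l})"
  let ?C = "{S \<in> segments d L l. continuous_segment d L S}"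
  have N: "N * 2 ^ j = 2 ^ (d * L)" using j by (simp add: N_def flip: power_add)
  have card_seg: "card (segments d L l) = 2 ^ (d * L) - (l - 1)"
    using card_segments l by blast
  have pos: "0 < card (segments d L l)" using card_seg l by simp
  have "inj_on h ({..<N} \<times> T)"
  proof (rule inj_onI, clarify)
    fix a t a' t' assume "t \<in> T" "t' \<in> T" and h: "h (a, t) = h (a', t')"
    then have t: "t < 2 ^ j" "t' < 2 ^ j" using T[of t] T[of t'] l by auto
    have eq: "a * 2 ^ j + t = a' * 2 ^ j + t'"
      using h l by (auto simp: h_def atLeastLessThan_eq_iff)
    \<comment> \<open>Offsets are below 2^j, so block number and offset are quotient and remainder
      of the starting index.\<close>
    have "a = (a * 2 ^ j + t) div 2 ^ j" "a' = (a' * 2 ^ j + t') div 2 ^ j" using t by simp_all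
    then have "a = a'" using eq by simp
    then show "a = a' \<and> t = t'" using eq by simp
  qed
  then have "N * card T = card (h ` ({..<N} \<times> T))"
    by (simp add: card_image card_cartesian_product)
  also have "\<dots> \<le> card ?C"
  proof (rule card_mono)
    show "finite ?C" using pos by (simp add: card_gt_0_iff)
  next
    have "{a * 2 ^ j + t..<a * 2 ^ j + t + l} \<in> segments d L l" if "a < N" "t \<in> T" for a t
    proof -
      have "a * 2 ^ j + t + l \<le> (a + 1) * 2 ^ j" using T[OF that(2)] by simp
      also have "\<dots> \<le> N * 2 ^ j" using that(1) by (intro mult_right_mono) auto
      finally show ?thesis unfolding N segments_def by fastforce
    qed
    then show "h ` ({..<N} \<times> T) \<subseteq> ?C" using cont by (auto simp: h_def)
  qed
  finally have C: "N * card T \<le> card ?C" .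
  have "card (segments d L l) \<le> N * 2 ^ j" by (simp add: card_seg N)
  also have "\<dots> \<le> N * (card T * (2 ^ d - 1))" using card_T by (rule mult_left_mono) simp
  also have "\<dots> \<le> card ?C * (2 ^ d - 1)"
    unfolding mult.assoc[symmetric] using C by (rule mult_right_mono) simp
  finally have "real (card (segments d L l)) \<le> real (card ?C * (2 ^ d - 1))"
    by (rule of_nat_mono)
  also have "\<dots> = real (card ?C) * (2 ^ d - 1)" by (simp add: of_nat_diff)
  finally have "real (card (segments d L l)) \<le> real (card ?C) * (2 ^ d - 1)" .
  moreover have "(0::real) < 2 ^ d - 1" using d by simp
  ultimately show ?thesis using pos by (simp add: phi_def field_simps)
qed

theorem theorem24:
  fixes d L l :: nat
  assumes "1 \<le> d" and "1 \<le> l" and "l \<le> 2 ^ (d * L)"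
  shows "phi d L l \<ge> 1 / (2 ^ d - 1)"
proof -
  have "(1::real) \<le> 2 ^ d - 1"
    using power_increasing[of 1 d "2::real"] assms(1) by simp
  then have one: "1 / (2 ^ d - 1) \<le> (1::real)" by simp
  define k where "k = (LEAST k. l \<le> 2 ^ k)"
  have lk: "l \<le> 2 ^ k" unfolding k_def using assms(3) by (rule LeastI)
  have kL: "k \<le> d * L" unfolding k_def using assms(3) by (rule Least_le)
  \<comment> \<open>Minimality of k makes l exceed half of 2^k, as
    \<open>continuous_within_box\<close> requires.\<close>
  have l2: "2 ^ k < 2 * l"
  proof (cases k)
    case 0
    then show ?thesis using assms(2) by simp
  next
    case (Suc m)
    then have "\<not> l \<le> 2 ^ m" using not_less_Least[of m "\<lambda>k. l \<le> 2 ^ k"] by (simp add: k_def)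
    then show ?thesis by (simp add: Suc)
  qed
  define f where "f = 2 ^ k - l"
  have f: "l + f = 2 ^ k" "2 * f < 2 ^ k" using lk l2 by (auto simp: f_def)
  consider "carry d k \<le> f" | "f < carry d k" "d = 1" | "f < carry d k" "k = d * L"
    | "f < carry d k" "2 \<le> d" "k < d * L"
    using assms(1) kL by linarith
  then show ?thesis
  proof cases
    case 1
    \<comment> \<open>The f + 1 offsets that keep the segment inside its block already suffice
      here.\<close>
    have "2 ^ k \<le> (f + 1) * (2 ^ d - 1)"
      using carry_ge[OF assms(1), of k] mult_right_mono[of "carry d k + 1" "f + 1" "2 ^ d - 1"] 1
      by linarith
    then show ?thesis
      using assms kL f l2
      by (intro phi_ge[where T = "{..f}" and j = k] continuous_within_box) auto
  next
    case 2
    have "phi d L l = 1"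
      using assms(2,3) by (intro phi_eq_1) (auto simp: 2(2) intro: continuous_one_dim[simplified])
    then show ?thesis using one by simp
  next
    case 3
    \<comment> \<open>The whole curve is a single block of length 2^k, numbered 0, which contains
      every segment.\<close>
    have "phi d L l = 1"
      using assms(2,3) continuous_within_box[OF kL l2, of _ 0] 3 by (intro phi_eq_1) auto
    then show ?thesis using one by simp
  next
    case 4
    let ?T = "{..carry d k} \<union> {2 ^ k + f - carry d k..2 ^ k + f}"
    have c: "2 * carry d k < 2 ^ k" using double_carry_less 4 by blast
    show ?thesis
    proof (rule phi_ge[where T = ?T and j = "Suc k"])
      show "t + l \<le> 2 ^ Suc k" if "t \<in> ?T" for t using that c f 4 by auto
      show "continuous_segment d L {a * 2 ^ Suc k + t..<a * 2 ^ Suc k + t + l}"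
        if "t \<in> ?T" for a t
        using continuous_across_boxes[OF 4(3) f(1) 4(1) f(2) that] .
      \<comment> \<open>Since 2R < 2^k, the two ranges are disjoint, with R + 1 offsets each; the
        factor 2 matches the doubled block length.\<close>
      have "card ?T = 2 * (carry d k + 1)"
        using c 4 by (subst card_Un_disjoint) auto
      then show "2 ^ Suc k \<le> card ?T * (2 ^ d - 1)" using carry_ge[OF assms(1), of k] by simp
    qed (use assms 4 in auto)
  qed
qed

end
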